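(* The equation $z^2 = \frac{T_x + T_y}{2}$ has infinitely many non-trivial solutions in integers $x, y, z$; that is, there are infinitely many non-constant three-term arithmetic progressions of the form $T_x, z^2, T_y$.
   Context: $T_n = \frac{n(n+1)(n+2)}{6}$ denotes the $n$-th tetrahedral number. A solution is non-trivial if $x \neq y$. *)

theory Defs
  imports Complex_Main
begin

definition tetrahedral :: "int \<Rightarrow> rat" where
  "tetrahedral n = of_int (n * (n + 1) * (n + 2)) / 6"

definition is_AP3 :: "rat \<Rightarrow> rat \<Rightarrow> rat \<Rightarrow> bool" where
  "is_AP3 a b c \<longleftrightarrow> b - a = c - b"

definition nonconstant_AP3 :: "rat \<Rightarrow> rat \<Rightarrow> rat \<Rightarrow> bool" where
  "nonconstant_AP3 a b c \<longleftrightarrow> is_AP3 a b c \<and> \<not> (a = b \<and> b = c)"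

end

theory Submission
  imports Defs
begin

text \<open>
  With \<open>S = x + y + 2\<close> and \<open>D = x - y\<close> one has \<open>T\<^sub>x + T\<^sub>y = S (S\<^sup>2 + 3 D\<^sup>2 - 4) / 24\<close>.
  On the line \<open>3 D = S - 4\<close>, parametrised by \<open>S = 12 u + 1\<close> and \<open>D = 4 u - 1\<close>, the second
  factor collapses to \<open>192 u\<^sup>2\<close>. Hence \<open>(T\<^sub>x + T\<^sub>y) / 2 = (2 u)\<^sup>2 (12 u + 1)\<close>, which is a
  square as soon as \<open>12 u + 1\<close> is one, and this happens for infinitely many \<open>u\<close>.
\<close>

lemma nonconstant_AP3_iff: "nonconstant_AP3 a b c \<longleftrightarrow> b = (a + c) / 2 \<and> a \<noteq> c"
  by (auto simp: nonconstant_AP3_def is_AP3_def field_simps)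

lemma tetrahedral_strict_mono_on: "strict_mono_on {0..} tetrahedral"
proof (rule strict_mono_onI)
  fix m n :: int
  assume "m \<in> {0..}" "m < n"
  then have "m * (m + 1) * (m + 2) < n * (n + 1) * (n + 2)"
    by (intro mult_strict_mono) auto
  then show "tetrahedral m < tetrahedral n"
    unfolding tetrahedral_def by (intro divide_strict_right_mono) (auto simp only: of_int_less_iff)
qed

lemma tetrahedral_add:
  "tetrahedral x + tetrahedral y =
    rat_of_int ((x + y + 2) * ((x + y + 2)\<^sup>2 + 3 * (x - y)\<^sup>2 - 4)) / 24"
  by (simp add: tetrahedral_def field_simps power2_eq_square)

lemma nonconstant_AP3_tetrahedral_square:
  assumes "0 < u" and square: "s\<^sup>2 = 12 * u + 1"
  shows "nonconstant_AP3 (tetrahedral (8 * u - 1)) ((rat_of_int (2 * u * s))\<^sup>2) (tetrahedral (4 * u))"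
proof -
  have collapse: "(12 * u + 1)\<^sup>2 + 3 * (4 * u - 1)\<^sup>2 - 4 = 192 * u\<^sup>2"
    by (simp add: power2_eq_square algebra_simps)
  have "tetrahedral (8 * u - 1) + tetrahedral (4 * u) =
      rat_of_int ((12 * u + 1) * ((12 * u + 1)\<^sup>2 + 3 * (4 * u - 1)\<^sup>2 - 4)) / 24"
    using tetrahedral_add[of "8 * u - 1" "4 * u"] by (simp add: add.commute)
  also have "\<dots> = 2 * rat_of_int ((2 * u)\<^sup>2 * s\<^sup>2)"
    unfolding collapse square by simp
  finally have "(rat_of_int (2 * u * s))\<^sup>2 = (tetrahedral (8 * u - 1) + tetrahedral (4 * u)) / 2"
    by (simp add: power_mult_distrib)
  moreover have "tetrahedral (4 * u) < tetrahedral (8 * u - 1)"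
    using \<open>0 < u\<close> by (intro strict_mono_onD[OF tetrahedral_strict_mono_on]) auto
  ultimately show ?thesis
    by (simp add: nonconstant_AP3_iff)
qed

lemma infinite_squares_cong_1:
  fixes m :: int
  assumes "0 \<le> m"
  shows "infinite {u. 0 < u \<and> (\<exists>s. s\<^sup>2 = m * u + 1)}"
proof (rule infinite_super)
  let ?u = "\<lambda>k. k * (m * k + 2)"
  show "?u ` {1..} \<subseteq> {u. 0 < u \<and> (\<exists>s. s\<^sup>2 = m * u + 1)}"
  proof (intro image_subsetI CollectI conjI exI)
    fix k :: int
    assume "k \<in> {1..}"
    with assms show "0 < ?u k"
      by (simp add: add_nonneg_pos)
    show "(m * k + 1)\<^sup>2 = m * ?u k + 1"
      by (simp add: power2_eq_square algebra_simps)
  qed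
  have "strict_mono_on {1..} ?u"
    using assms
    by (intro strict_mono_onI mult_less_le_imp_less) (auto simp: mult_left_mono add_nonneg_pos)
  then show "infinite (?u ` {1..})"
    by (simp add: finite_image_iff strict_mono_on_imp_inj_on infinite_Ici)
qed

lemma infinite_tetrahedral_square_AP3:
  "infinite {(tetrahedral x, (rat_of_int z)\<^sup>2, tetrahedral y) | x y z.
     x \<ge> 1 \<and> y \<ge> 1 \<and>
     nonconstant_AP3 (tetrahedral x) ((rat_of_int z)\<^sup>2) (tetrahedral y)}"
    (is "infinite ?A")
proof -
  let ?U = "{u::int. 0 < u \<and> (\<exists>s. s\<^sup>2 = 12 * u + 1)}"
  have "strict_mono_on ?U (\<lambda>u. tetrahedral (4 * u))"
    by (intro strict_mono_onI strict_mono_onD[OF tetrahedral_strict_mono_on]) auto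
  then have "infinite ((\<lambda>u. tetrahedral (4 * u)) ` ?U)"
    using infinite_squares_cong_1[of 12] by (simp add: finite_image_iff strict_mono_on_imp_inj_on)
  moreover have "(\<lambda>u. tetrahedral (4 * u)) ` ?U \<subseteq> (\<lambda>(a, b, c). c) ` ?A"
  proof (rule image_subsetI)
    fix u
    assume "u \<in> ?U"
    then obtain s where "0 < u" "s\<^sup>2 = 12 * u + 1" by blast
    then have "(tetrahedral (8 * u - 1), (rat_of_int (2 * u * s))\<^sup>2, tetrahedral (4 * u)) \<in> ?A"
      by (intro CollectI exI[of _ "8 * u - 1"] exI[of _ "4 * u"] exI[of _ "2 * u * s"] conjI refl
          nonconstant_AP3_tetrahedral_square) auto
    then show "tetrahedral (4 * u) \<in> (\<lambda>(a, b, c). c) ` ?A"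
      by (rule rev_image_eqI) simp
  qed
  ultimately show ?thesis
    using finite_surj by blast
qed

theorem theorem4p2:
  shows "infinite {(x, y, z).
           (rat_of_int z)\<^sup>2 = (tetrahedral x + tetrahedral y) / 2 \<and> x \<noteq> y}
       \<and> infinite {(tetrahedral x, (rat_of_int z)\<^sup>2, tetrahedral y) | x y z.
           x \<ge> 1 \<and> y \<ge> 1 \<and>
           nonconstant_AP3 (tetrahedral x) ((rat_of_int z)\<^sup>2) (tetrahedral y)}"
    (is "infinite ?S \<and> infinite ?A")
proof
  show "infinite ?A"
    by (rule infinite_tetrahedral_square_AP3)
  moreover have "?A \<subseteq> (\<lambda>(x, y, z). (tetrahedral x, (rat_of_int z)\<^sup>2, tetrahedral y)) ` ?S"
    by (force simp: nonconstant_AP3_iff)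
  ultimately show "infinite ?S"
    using finite_surj by blast
qed

end
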